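(* Let $S$ be a numerical semigroup with multiplicity $m$, minimal generators $m<n_1<\dots<n_k$, and Kunz poset $P$, and let $\rho$ be an $m$-centric minimal presentation of $S$. Then (a) the set $\rho'=\{(\widehat z,\widehat{z'}) : (z,z')\in\rho\text{ and } z_0=0\}$ is a minimal presentation of $P$; and (b) the set $\{\widehat{z'} : (z,z')\in\rho\text{ and } z_0>0\}$ consists of exactly one factorization from each outer Betti element of $P$.
   Context: A numerical semigroup is a cofinite submonoid $S$ of $(\mathbb Z_{\ge0},+)$; its multiplicity $m$ is its smallest positive element. $\mathrm{Ap}(S;m)=\{n\in S:n-m\notin S\}=\{0,a_1,\dots,a_{m-1}\}$ with $a_i\equiv i\pmod m$, $a_0=0$. Kunz poset $P$: $\mathbb Z_m$ with $i\preceq j$ iff $a_j-a_i\in\mathrm{Ap}(S;m)$. Kunz nilsemigroup $N=\mathbb Z_m\cup\{\infty\}$, $\infty$ absorbing, $i\oplus j=i+j$ if $a_i+a_j=a_{i+j}$ and $\infty$ otherwise; its atoms are $p_i=n_i\bmod m$. For $u\in N$, $\mathsf Z_P(u)=\{w\in\mathbb Z_{\ge0}^k: w_1p_1\oplus\dots\oplus w_kp_k=u\}$, and $\varphi_P(w)=w_1p_1\oplus\dots\oplus w_kp_k$. A minimal presentation of $P$ is a set obtained from a minimal (under inclusion) generating set of the congruence $\ker\varphi_P=\{(w,w'):\varphi_P(w)=\varphi_P(w')\}$ on $\mathbb Z_{\ge0}^k$ by deleting all pairs $(w,w')$ with $\varphi_P(w)=\infty$. Outer Betti elements: for $w\in\mathbb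 Z_{\ge0}^k$, $\operatorname{supp}(w)=\{i:w_i>0\}$; for a set $B$, $\operatorname{supp}(B)=\bigcup_{w\in B}\operatorname{supp}(w)$ and $B-e_i=\{w-e_i:w\in B,\ i\in\operatorname{supp}(w)\}$; $\nabla_B$ is the graph on $B$ with $w,w'$ adjacent iff their supports intersect. An outer Betti element of $P$ is a set $B\subseteq\mathsf Z_P(\infty)$ such that (i) for each $i\in\operatorname{supp}(B)$, $B-e_i=\mathsf Z_P(p)$ for some $p\in\mathbb Z_m$, and (ii) $\nabla_B$ is connected. Factorizations of $S$: $\varphi_S(z)=z_0m+\sum_{i\ge1}z_in_i$ for $z\in\mathbb Z_{\ge0}^{k+1}$; a presentation of $S$ is a set $\rho$ of ordered pairs $(z,z')$ with $\varphi_S(z)=\varphi_S(z')$ such that the smallest congruence on $\mathbb Z_{\ge0}^{k+1}$ containing $\rho$ is $\ker\varphi_S$; minimal means minimal under inclusion. For $z\in\mathbb Z_{\ge0}^{k+1}$, $\widehat z=(z_1,\dots,z_k)$ and $\overline z=z_1p_1+\dots+z_kp_k\in\mathbb Z_m$. A relation $(z,z')\in\rho$ is $m$-centric if $\widehat z\in\mathsf Z_P(\overline z)$, and $\rho$ is $m$-centric if all its relations are. *)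

theory Defs
  imports HOL.Hull "HOL-Library.Function_Algebras"
begin

text \<open>
  The class \<open>\<int>\<^sub>m\<close> is represented by the residues \<open>{0..<m}\<close>.  Vectors are functions
  \<open>nat \<Rightarrow> nat\<close> that vanish outside their index set, with pointwise addition: \<open>{1..k}\<close> is the
  index set for \<open>\<int>\<^sub>\<ge>\<^sub>0\<^sup>k\<close> and \<open>{0..k}\<close> the one for \<open>\<int>\<^sub>\<ge>\<^sub>0\<^sup>k\<^sup>+\<^sup>1\<close>.  The generator
  sequence \<open>n\<close> is only ever evaluated on \<open>{1..k}\<close>; the case \<open>k = 0\<close> (that is, \<open>m = 1\<close>) is allowed.
\<close>

definition minimal_generating :: "('a set \<Rightarrow> bool) \<Rightarrow> 'a set \<Rightarrow> 'a set \<Rightarrow> bool" where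
  "minimal_generating C A X \<longleftrightarrow> C hull A = X \<and> (\<forall>B. B \<subset> A \<longrightarrow> C hull B \<noteq> X)"


subsection \<open>Numerical semigroups\<close>

definition submonoid :: "nat set \<Rightarrow> bool" where
  "submonoid T \<longleftrightarrow> 0 \<in> T \<and> (\<forall>x\<in>T. \<forall>y\<in>T. x + y \<in> T)"

definition numerical_semigroup :: "nat set \<Rightarrow> bool" where
  "numerical_semigroup S \<longleftrightarrow> submonoid S \<and> finite (- S)"

definition mult :: "nat set \<Rightarrow> nat" where
  "mult S = (LEAST s. s \<in> S \<and> 0 < s)"

definition minimal_generators :: "nat set \<Rightarrow> nat \<Rightarrow> (nat \<Rightarrow> nat) \<Rightarrow> bool" where
  "minimal_generators S k n \<longleftrightarrow>
     strict_mono_on {1..k} n \<and> (\<forall>i\<in>{1..k}. mult S < n i) \<and>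
     minimal_generating submonoid (insert (mult S) (n ` {1..k})) S"

definition Apery :: "nat set \<Rightarrow> nat \<Rightarrow> nat set" where
  "Apery S s = {x \<in> S. \<not> (s \<le> x \<and> x - s \<in> S)}"

definition apery_elt :: "nat set \<Rightarrow> nat \<Rightarrow> nat" where
  "apery_elt S i = (THE x. x \<in> Apery S (mult S) \<and> x mod mult S = i mod mult S)"


subsection \<open>Kunz poset and Kunz nilsemigroup\<close>

definition kunz_le :: "nat set \<Rightarrow> nat \<Rightarrow> nat \<Rightarrow> bool" where
  "kunz_le S i j \<longleftrightarrow> i < mult S \<and> j < mult S \<and> apery_elt S i \<le> apery_elt S j \<and>
     apery_elt S j - apery_elt S i \<in> Apery S (mult S)"

text \<open>
  The absorbing element \<open>\<infinity>\<close> is \<^const>\<open>None\<close>.  The lemma \<open>kunz_add_iff_kunz_le\<close> below shows that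
  the operation depends only on the Kunz poset.
\<close>

fun kunz_add :: "nat set \<Rightarrow> nat option \<Rightarrow> nat option \<Rightarrow> nat option" where
  "kunz_add S (Some i) (Some j) =
     (if apery_elt S i + apery_elt S j = apery_elt S ((i + j) mod mult S)
      then Some ((i + j) mod mult S) else None)"
| "kunz_add S None v = None"
| "kunz_add S u None = None"

definition kunz_scale :: "nat set \<Rightarrow> nat \<Rightarrow> nat option \<Rightarrow> nat option" where
  "kunz_scale S c u = (kunz_add S u ^^ c) (Some 0)"

definition atom :: "nat set \<Rightarrow> (nat \<Rightarrow> nat) \<Rightarrow> nat \<Rightarrow> nat" where
  "atom S n i = n i mod mult S"

text \<open>
  The operation is associative and commutative with neutral element \<open>Some 0\<close> on the
  nilsemigroup, so the order and bracketing chosen for the sum are immaterial.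
\<close>

definition phi_P :: "nat set \<Rightarrow> nat \<Rightarrow> (nat \<Rightarrow> nat) \<Rightarrow> (nat \<Rightarrow> nat) \<Rightarrow> nat option" where
  "phi_P S k n w =
     foldr (\<lambda>i. kunz_add S (kunz_scale S (w i) (Some (atom S n i)))) [1..<Suc k] (Some 0)"

definition vecs :: "nat set \<Rightarrow> (nat \<Rightarrow> nat) set" where
  "vecs I = {w. \<forall>i. i \<notin> I \<longrightarrow> w i = 0}"

definition Z_P :: "nat set \<Rightarrow> nat \<Rightarrow> (nat \<Rightarrow> nat) \<Rightarrow> nat option \<Rightarrow> (nat \<Rightarrow> nat) set" where
  "Z_P S k n u = {w \<in> vecs {1..k}. phi_P S k n w = u}"


subsection \<open>Congruences and presentations\<close>

definition congruence :: "'a::monoid_add set \<Rightarrow> ('a \<times> 'a) set \<Rightarrow> bool" where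
  "congruence M R \<longleftrightarrow> equiv M R \<and> (\<forall>(x, y)\<in>R. \<forall>u\<in>M. (x + u, y + u) \<in> R)"

definition ker_on :: "'a set \<Rightarrow> ('a \<Rightarrow> 'b) \<Rightarrow> ('a \<times> 'a) set" where
  "ker_on M f = {(x, y). x \<in> M \<and> y \<in> M \<and> f x = f y}"

definition minimal_presentation_P ::
  "nat set \<Rightarrow> nat \<Rightarrow> (nat \<Rightarrow> nat) \<Rightarrow> ((nat \<Rightarrow> nat) \<times> (nat \<Rightarrow> nat)) set \<Rightarrow> bool" where
  "minimal_presentation_P S k n \<rho> \<longleftrightarrow>
     (\<exists>\<sigma>. minimal_generating (congruence (vecs {1..k})) \<sigma> (ker_on (vecs {1..k}) (phi_P S k n)) \<and>
          \<rho> = {(w, w') \<in> \<sigma>. phi_P S k n w \<noteq> None})"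

definition phi_S :: "nat set \<Rightarrow> nat \<Rightarrow> (nat \<Rightarrow> nat) \<Rightarrow> (nat \<Rightarrow> nat) \<Rightarrow> nat" where
  "phi_S S k n z = z 0 * mult S + (\<Sum>i=1..k. z i * n i)"

definition minimal_presentation_S ::
  "nat set \<Rightarrow> nat \<Rightarrow> (nat \<Rightarrow> nat) \<Rightarrow> ((nat \<Rightarrow> nat) \<times> (nat \<Rightarrow> nat)) set \<Rightarrow> bool" where
  "minimal_presentation_S S k n \<rho> \<longleftrightarrow>
     minimal_generating (congruence (vecs {0..k})) \<rho> (ker_on (vecs {0..k}) (phi_S S k n))"

definition hat :: "(nat \<Rightarrow> nat) \<Rightarrow> nat \<Rightarrow> nat" where
  "hat z = z(0 := 0)"

definition bar :: "nat set \<Rightarrow> nat \<Rightarrow> (nat \<Rightarrow> nat) \<Rightarrow> (nat \<Rightarrow> nat) \<Rightarrow> nat" where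
  "bar S k n z = (\<Sum>i=1..k. z i * atom S n i) mod mult S"

definition m_centric ::
  "nat set \<Rightarrow> nat \<Rightarrow> (nat \<Rightarrow> nat) \<Rightarrow> ((nat \<Rightarrow> nat) \<times> (nat \<Rightarrow> nat)) set \<Rightarrow> bool" where
  "m_centric S k n \<rho> \<longleftrightarrow> (\<forall>(z, z')\<in>\<rho>. hat z \<in> Z_P S k n (Some (bar S k n z)))"


subsection \<open>Outer Betti elements\<close>

definition supp :: "(nat \<Rightarrow> nat) \<Rightarrow> nat set" where
  "supp w = {i. 0 < w i}"

definition remove_atom :: "(nat \<Rightarrow> nat) set \<Rightarrow> nat \<Rightarrow> (nat \<Rightarrow> nat) set" where
  "remove_atom B i = {w(i := w i - 1) | w. w \<in> B \<and> i \<in> supp w}"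

definition nabla :: "(nat \<Rightarrow> nat) set \<Rightarrow> ((nat \<Rightarrow> nat) \<times> (nat \<Rightarrow> nat)) set" where
  "nabla B = {(w, w'). w \<in> B \<and> w' \<in> B \<and> supp w \<inter> supp w' \<noteq> {}}"

text \<open>
  As usual, the graph without vertices does not count as connected; so outer Betti elements
  are nonempty.
\<close>

definition nabla_connected :: "(nat \<Rightarrow> nat) set \<Rightarrow> bool" where
  "nabla_connected B \<longleftrightarrow> B \<noteq> {} \<and> (\<forall>w\<in>B. \<forall>w'\<in>B. (w, w') \<in> (nabla B)\<^sup>*)"

definition outer_betti :: "nat set \<Rightarrow> nat \<Rightarrow> (nat \<Rightarrow> nat) \<Rightarrow> (nat \<Rightarrow> nat) set \<Rightarrow> bool" where
  "outer_betti S k n B \<longleftrightarrow>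
     B \<subseteq> Z_P S k n None \<and>
     (\<forall>i\<in>(\<Union>w\<in>B. supp w). \<exists>p<mult S. remove_atom B i = Z_P S k n (Some p)) \<and>
     nabla_connected B"


subsection \<open>The Kunz nilsemigroup is determined by the Kunz poset\<close>

lemma mult_in:
  assumes "numerical_semigroup S"
  shows "mult S \<in> S" "0 < mult S"
proof -
  have "infinite S"
    using assms unfolding numerical_semigroup_def by (metis finite_compl infinite_UNIV_nat)
  then obtain s where "s \<in> S" "0 < s"
    by (metis finite_nat_set_iff_bounded_le gr0I le0)
  then have "mult S \<in> S \<and> 0 < mult S"
    unfolding mult_def by (intro LeastI[where P = "\<lambda>s. s \<in> S \<and> 0 < s"]) simp
  then show "mult S \<in> S" "0 < mult S" by auto
qed

lemma submonoid_add_mult: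
  assumes "submonoid S" "x \<in> S" "s \<in> S"
  shows "x + s * c \<in> S"
  using assms by (induction c) (auto simp: submonoid_def algebra_simps)

lemma Apery_unique:
  assumes "numerical_semigroup S" "x \<in> Apery S (mult S)" "y \<in> Apery S (mult S)"
    and "x mod mult S = y mod mult S"
  shows "x = y"
proof -
  have *: "\<not> u < v" if u: "u \<in> Apery S (mult S)" and v: "v \<in> Apery S (mult S)"
    and e: "u mod mult S = v mod mult S" for u v
  proof
    assume "u < v"
    with e obtain c where c: "v = u + mult S * c"
      using mod_eq_nat1E[of v "mult S" u] by force
    with \<open>u < v\<close> obtain d where d: "c = Suc d" by (cases c) auto
    have "v - mult S = u + mult S * d" "mult S \<le> v" using c d by auto
    moreover have "u + mult S * d \<in> S"
      using assms(1) u mult_in(1)[OF assms(1)]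
      by (intro submonoid_add_mult) (auto simp: numerical_semigroup_def Apery_def)
    ultimately show False using v by (auto simp: Apery_def)
  qed
  show ?thesis using *[of x y] *[of y x] assms by force
qed

lemma Apery_exists:
  assumes "numerical_semigroup S"
  shows "\<exists>x. x \<in> Apery S (mult S) \<and> x mod mult S = i mod mult S"
proof -
  define m where "m = mult S"
  have m: "0 < m" using mult_in[OF assms] by (simp add: m_def)
  obtain b where b: "\<And>x. x \<notin> S \<Longrightarrow> x < b"
    using assms unfolding numerical_semigroup_def
    by (metis ComplI finite_nat_set_iff_bounded)
  define Q where "Q = (\<lambda>x. x \<in> S \<and> x mod m = i mod m)"
  have "b \<le> i + m * b" using m by (simp add: trans_le_add2)
  then have "Q (i + m * b)" using b[of "i + m * b"] by (auto simp: Q_def)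
  then have L: "Q (Least Q)" by (rule LeastI)
  have "\<not> (m \<le> Least Q \<and> Least Q - m \<in> S)"
  proof
    assume a: "m \<le> Least Q \<and> Least Q - m \<in> S"
    then have "Q (Least Q - m)" using L by (simp add: Q_def le_mod_geq)
    then have "Least Q \<le> Least Q - m" by (rule Least_le)
    with a m show False by linarith
  qed
  with L show ?thesis unfolding Apery_def Q_def m_def by blast
qed

lemma apery_elt:
  assumes "numerical_semigroup S"
  shows "apery_elt S i \<in> Apery S (mult S)" "apery_elt S i mod mult S = i mod mult S"
proof -
  have "\<exists>!x. x \<in> Apery S (mult S) \<and> x mod mult S = i mod mult S"
    using Apery_exists[OF assms, of i] Apery_unique[OF assms] by metis
  from theI'[OF this] show "apery_elt S i \<in> Apery S (mult S)"
    "apery_elt S i mod mult S = i mod mult S"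
    by (auto simp: apery_elt_def)
qed

lemma kunz_add_iff_kunz_le:
  assumes S: "numerical_semigroup S" and ij: "i < mult S" "j < mult S"
  shows "kunz_add S (Some i) (Some j) =
    (if kunz_le S i ((i + j) mod mult S) then Some ((i + j) mod mult S) else None)"
proof -
  define l where "l = (i + j) mod mult S"
  have l: "l < mult S" using ij by (simp add: l_def)
  have "apery_elt S i + apery_elt S j = apery_elt S l" if k: "kunz_le S i l"
  proof -
    define d where "d = apery_elt S l - apery_elt S i"
    have d: "d \<in> Apery S (mult S)" "apery_elt S l = apery_elt S i + d"
      using k by (auto simp: kunz_le_def d_def)
    have "(apery_elt S i + d) mod mult S = (i + j) mod mult S"
      using apery_elt(2)[OF S, of l] d(2) by (simp add: l_def)
    then have "(int (apery_elt S i) + int d) mod int (mult S) = (int i + int j) mod int (mult S)"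
      by (metis of_nat_add of_nat_mod)
    moreover have "int (apery_elt S i) mod int (mult S) = int i mod int (mult S)"
      using apery_elt(2)[OF S, of i] by (metis of_nat_mod)
    ultimately have "int d mod int (mult S) = int j mod int (mult S)"
      by (metis add_diff_cancel_left' mod_diff_cong)
    then have "d mod mult S = j mod mult S"
      by (metis of_nat_eq_iff of_nat_mod)
    then have "d = apery_elt S j"
      using Apery_unique[OF S d(1) apery_elt(1)[OF S, of j]] apery_elt(2)[OF S, of j] by simp
    with d show ?thesis by simp
  qed
  moreover have "kunz_le S i l" if "apery_elt S i + apery_elt S j = apery_elt S l"
    using that apery_elt(1)[OF S, of j] ij l unfolding kunz_le_def
    by (metis add_diff_cancel_left' le_add1)
  ultimately show ?thesis unfolding l_def by auto
qed

end

(* Sending s to its residue if s lies in the Apery set and to infinity otherwise is a homomorphism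
   from S onto the Kunz nilsemigroup, so Z_P(i) is the set of factorizations of a_i in S, and the
   relations with z_0 = 0 are exactly those of Apery degree.  A chain of relations ending in a
   factorization of a_i uses only relations of Apery degree, whence (a).  In a degree b outside
   the Apery set, all factorizations involving m lie in one component of the factorization graph,
   and the other components are the outer Betti elements of degree b.  Minimality makes the
   relations of degree b a tree on the components; being m-centric makes it a star around the
   component of m, so each outer Betti element receives exactly one relation, whence (b). *)

theory Submission
  imports Defs
begin

subsection \<open>Congruences\<close>

lemma congruenceI:
  assumes "R \<subseteq> M \<times> M" "\<And>x. x \<in> M \<Longrightarrow> (x, x) \<in> R" "\<And>x y. (x, y) \<in> R \<Longrightarrow> (y, x) \<in> R"
    "\<And>x y z. (x, y) \<in> R \<Longrightarrow> (y, z) \<in> R \<Longrightarrow> (x, z) \<in> R"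
    "\<And>x y u. (x, y) \<in> R \<Longrightarrow> u \<in> M \<Longrightarrow> (x + u, y + u) \<in> R"
  shows "congruence M R"
  unfolding congruence_def
proof
  show "equiv M R"
    using assms by (intro equivI refl_onI symI transI) blast+
qed (use assms in blast)

lemma congruenceD:
  assumes "congruence M R"
  shows "R \<subseteq> M \<times> M" "x \<in> M \<Longrightarrow> (x, x) \<in> R" "(x, y) \<in> R \<Longrightarrow> (y, x) \<in> R"
    "(x, y) \<in> R \<Longrightarrow> (y, z) \<in> R \<Longrightarrow> (x, z) \<in> R" "(x, y) \<in> R \<Longrightarrow> u \<in> M \<Longrightarrow> (x + u, y + u) \<in> R"
proof -
  have *: "equiv M R" "\<forall>(x, y)\<in>R. \<forall>u\<in>M. (x + u, y + u) \<in> R"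
    using assms by (auto simp: congruence_def)
  then show "R \<subseteq> M \<times> M" "x \<in> M \<Longrightarrow> (x, x) \<in> R" "(x, y) \<in> R \<Longrightarrow> (y, x) \<in> R"
    "(x, y) \<in> R \<Longrightarrow> (y, z) \<in> R \<Longrightarrow> (x, z) \<in> R"
    by (auto simp: equiv_def refl_on_def dest: symD transD)
  show "(x, y) \<in> R \<Longrightarrow> u \<in> M \<Longrightarrow> (x + u, y + u) \<in> R" using *(2) by blast
qed

lemma congruence_hull:
  assumes "\<And>x y. x \<in> M \<Longrightarrow> y \<in> M \<Longrightarrow> x + y \<in> M" "A \<subseteq> M \<times> M"
  shows "congruence M (congruence M hull A)"
proof (rule congruenceI)
  \<comment> \<open>The total relation is itself a congruence, so the intersection that defines the
    hull is bounded by it.\<close>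
  have "congruence M (M \<times> M)" by (rule congruenceI) (use assms in auto)
  then show "congruence M hull A \<subseteq> M \<times> M" using assms(2) by (rule hull_minimal[rotated])
qed (auto simp: hull_def dest: congruenceD)

lemma congruence_ker_on:
  assumes "\<And>x y. x \<in> M \<Longrightarrow> y \<in> M \<Longrightarrow> x + y \<in> M"
    and "\<And>x y u. x \<in> M \<Longrightarrow> y \<in> M \<Longrightarrow> u \<in> M \<Longrightarrow> f x = f y \<Longrightarrow> f (x + u) = f (y + u)"
  shows "congruence M (ker_on M f)"
  by (rule congruenceI) (use assms in \<open>auto simp: ker_on_def\<close>)

text \<open>Pairs inside an order ideal \<open>G\<close> are already related by the generators inside \<open>G\<close>, even
  over another monoid \<open>N\<close> containing all cofactors that can occur in \<open>G\<close>.\<close>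

lemma congruence_hull_restrict:
  assumes K: "congruence M (ker_on M f)" and \<rho>: "\<rho> \<subseteq> ker_on M f"
    and N: "\<And>x y. x \<in> N \<Longrightarrow> y \<in> N \<Longrightarrow> x + y \<in> N" "A \<subseteq> N \<times> N"
    and G: "\<And>x y. x \<in> G \<Longrightarrow> x \<in> M \<Longrightarrow> y \<in> M \<Longrightarrow> f x = f y \<Longrightarrow> y \<in> G"
    "\<And>x u. x \<in> M \<Longrightarrow> u \<in> M \<Longrightarrow> x + u \<in> G \<Longrightarrow> x \<in> G \<and> u \<in> N"
    "G \<subseteq> N"
    and A: "\<And>x y. (x, y) \<in> \<rho> \<Longrightarrow> x \<in> G \<Longrightarrow> (x, y) \<in> A"
    and xy: "(x, y) \<in> congruence M hull \<rho>" "x \<in> G"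
  shows "(x, y) \<in> congruence N hull A"
proof -
  define H where "H = congruence N hull A"
  \<comment> \<open>\<open>T\<close> is a congruence containing \<open>\<rho>\<close>. Testing only
    the first component against \<open>G\<close> is enough, since within \<open>M\<close> the set
    \<open>G\<close> is a union of fibres of \<open>f\<close>.\<close>
  define T where "T = {(x, y) \<in> ker_on M f. x \<in> G \<longrightarrow> (x, y) \<in> H}"
  have H: "congruence N H" unfolding H_def by (rule congruence_hull) (use N in auto)
  have AH: "A \<subseteq> H" by (auto simp: H_def intro: hull_inc)
  have "congruence M T"
  proof (rule congruenceI)
    fix x y u assume "(x, y) \<in> T" "u \<in> M"
    then show "(x + u, y + u) \<in> T"
      using congruenceD(1)[OF K] congruenceD(5)[OF K] congruenceD(5)[OF H] G(2)[of x u]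
      unfolding T_def by blast
  next
    fix x y assume "(x, y) \<in> T"
    then show "(y, x) \<in> T" using G(1)[of y x] congruenceD(3)[OF H] by (auto simp: T_def ker_on_def)
  next
    fix x y z assume "(x, y) \<in> T" "(y, z) \<in> T"
    then show "(x, z) \<in> T" using G(1)[of x y] congruenceD(4)[OF H]
      by (auto simp: T_def ker_on_def)
  qed (use G(3) congruenceD(2)[OF H] in \<open>auto simp: T_def ker_on_def\<close>)
  moreover have "\<rho> \<subseteq> T" using \<rho> A AH by (auto simp: T_def)
  ultimately have "congruence M hull \<rho> \<subseteq> T" by (rule hull_minimal[rotated])
  with xy show ?thesis by (auto simp: T_def H_def)
qed

lemma minimal_generating_irredundant:
  assumes "minimal_generating C A X" "a \<in> A"
  shows "a \<notin> C hull (A - {a})"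
proof
  assume "a \<in> C hull (A - {a})"
  then have "C hull (A - {a}) = C hull A"
    using assms(2) by (metis hull_redundant_eq insert_Diff)
  then show False using assms by (auto simp: minimal_generating_def)
qed


subsection \<open>Vectors\<close>

definition unit_vec :: "nat \<Rightarrow> nat \<Rightarrow> nat" where
  "unit_vec i = 0(i := 1)"

lemma unit_vec_in_vecs [simp]: "unit_vec i \<in> vecs I \<longleftrightarrow> i \<in> I"
  by (auto simp: unit_vec_def vecs_def)

lemma zero_in_vecs [simp]: "0 \<in> vecs I"
  by (simp add: vecs_def)

lemma add_in_vecs_iff [simp]: "x + y \<in> vecs I \<longleftrightarrow> x \<in> vecs I \<and> y \<in> vecs I"
  by (auto simp: vecs_def)

lemma decr_add_unit_vec:
  assumes "i \<in> supp w"
  shows "w(i := w i - 1) + unit_vec i = w"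
  using assms by (auto simp: unit_vec_def supp_def)

lemma supp_add [simp]: "supp (x + y) = supp x \<union> supp y"
  by (auto simp: supp_def)

lemma supp_unit_vec [simp]: "supp (unit_vec i) = {i}"
  by (auto simp: unit_vec_def supp_def)

lemma supp_subset: "w \<in> vecs I \<Longrightarrow> supp w \<subseteq> I"
  by (auto simp: supp_def vecs_def)

lemma supp_empty_iff: "supp w = {} \<longleftrightarrow> w = 0"
  by (auto simp: supp_def fun_eq_iff)

lemma in_suppE:
  assumes "i \<in> supp w"
  obtains v where "w = v + unit_vec i"
  using decr_add_unit_vec[OF assms] by metis

text \<open>Induction on the coordinate sum. The interval is arbitrary so that the rule serves both
  \<open>V\<close> and \<open>W\<close>.\<close>

lemma vecs_induct [consumes 1, case_names zero add]:
  assumes "w \<in> vecs {a..b}"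
    and "P 0" "\<And>w i. w \<in> vecs {a..b} \<Longrightarrow> i \<in> {a..b} \<Longrightarrow> P w \<Longrightarrow> P (w + unit_vec i)"
  shows "P w"
  using assms(1)
proof (induction "sum w {a..b}" arbitrary: w rule: less_induct)
  case less
  show ?case
  proof (cases "w = 0")
    case False
    then obtain i where i: "i \<in> supp w" using supp_empty_iff by blast
    then obtain v where v: "w = v + unit_vec i" by (rule in_suppE)
    have iI: "i \<in> {a..b}" using supp_subset[OF less.prems] i by auto
    have "v \<in> vecs {a..b}" using less.prems v by simp
    moreover have "sum v {a..b} < sum w {a..b}"
      unfolding v by (rule sum_strict_mono_ex1) (use iI in \<open>auto simp: unit_vec_def\<close>)
    ultimately show ?thesis using less.hyps assms(3) iI v by blast
  qed (use assms(2) in simp)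
qed

text \<open>Trades the truncated subtraction for an addition, to which additivity of
  \<open>phi_S\<close> applies.\<close>

lemma remove_atom_iff: "v \<in> remove_atom B i \<longleftrightarrow> v + unit_vec i \<in> B"
proof
  assume "v \<in> remove_atom B i"
  then show "v + unit_vec i \<in> B" by (auto simp: remove_atom_def decr_add_unit_vec simp del: One_nat_def)
next
  assume "v + unit_vec i \<in> B"
  then show "v \<in> remove_atom B i"
    unfolding remove_atom_def
    by (intro CollectI exI[of _ "v + unit_vec i"]) (auto simp: unit_vec_def supp_def)
qed


subsection \<open>Factorizations\<close>

locale kunz =
  fixes S :: "nat set" and k :: nat and n :: "nat \<Rightarrow> nat"
  assumes num: "numerical_semigroup S" and gens: "minimal_generators S k n"
begin

text \<open>\<open>induction\<close> over vectors leaves eta-expanded sums, which these rules would turn into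
  lambda abstractions.\<close>

declare plus_fun_apply [simp del] zero_fun_apply [simp del]

abbreviation "m \<equiv> mult S"
abbreviation "Ap \<equiv> Apery S m"
abbreviation "\<phi> \<equiv> phi_S S k n"
abbreviation "\<psi> \<equiv> phi_P S k n"
abbreviation "V \<equiv> vecs {0..k}"
abbreviation "W \<equiv> vecs {1..k}"

lemma W_subset_V: "W \<subseteq> V"
  by (auto simp: vecs_def)

lemma V_in_W_iff: "z \<in> V \<Longrightarrow> z \<in> W \<longleftrightarrow> z 0 = 0"
  by (force simp: vecs_def Suc_le_eq)

lemma m_pos: "0 < m" and m_in: "m \<in> S"
  using mult_in[OF num] by auto

lemma S_add: "x \<in> S \<Longrightarrow> y \<in> S \<Longrightarrow> x + y \<in> S" and zero_in_S: "0 \<in> S"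
  using num by (auto simp: numerical_semigroup_def submonoid_def)

lemma n_gt: "i \<in> {1..k} \<Longrightarrow> m < n i"
  using gens by (auto simp: minimal_generators_def)

lemma gens_minimal: "minimal_generating submonoid (insert m (n ` {1..k})) S"
  using gens by (auto simp: minimal_generators_def)

lemma n_in: "i \<in> {1..k} \<Longrightarrow> n i \<in> S"
proof -
  assume "i \<in> {1..k}"
  then have "n i \<in> submonoid hull insert m (n ` {1..k})" by (intro hull_inc) auto
  then show ?thesis using gens_minimal by (simp add: minimal_generating_def)
qed

lemma phi_S_add [simp]: "\<phi> (x + y) = \<phi> x + \<phi> y"
  by (simp add: phi_S_def sum.distrib algebra_simps plus_fun_apply)

lemma phi_S_0 [simp]: "\<phi> 0 = 0"
  by (simp add: phi_S_def zero_fun_apply)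

lemma phi_S_unit_vec_0 [simp]: "\<phi> (unit_vec 0) = m"
  by (simp add: phi_S_def unit_vec_def zero_fun_apply)

lemma phi_S_unit_vec [simp]: "i \<in> {1..k} \<Longrightarrow> \<phi> (unit_vec i) = n i"
proof -
  assume i: "i \<in> {1..k}"
  have "(\<Sum>j=1..k. unit_vec i j * n j) = (\<Sum>j=1..k. if j = i then n j else 0)"
    by (rule sum.cong) (auto simp: unit_vec_def zero_fun_apply)
  then show ?thesis using i by (simp add: phi_S_def unit_vec_def zero_fun_apply)
qed

lemma phi_S_unit_vec_pos: "i \<in> {0..k} \<Longrightarrow> 0 < \<phi> (unit_vec i)"
  using m_pos n_gt[of i] by (cases "i = 0") auto

lemma phi_S_in: "z \<in> V \<Longrightarrow> \<phi> z \<in> S"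
proof (induction z rule: vecs_induct)
  case (add w i)
  then show ?case using m_in n_in[of i] by (cases "i = 0") (auto intro: S_add)
qed (auto simp: zero_in_S)

text \<open>The values of \<open>\<phi>\<close> on \<open>V\<close> form a submonoid containing all
  generators, hence the submonoid they generate.\<close>

lemma S_factorization:
  assumes "s \<in> S"
  obtains z where "z \<in> V" "\<phi> z = s"
proof -
  have "submonoid (\<phi> ` V)"
    unfolding submonoid_def by (auto intro!: rev_image_eqI[where x = 0] simp flip: phi_S_add)
  moreover have "insert m (n ` {1..k}) \<subseteq> \<phi> ` V"
    by (auto intro: rev_image_eqI[where x = "unit_vec 0"] rev_image_eqI[where x = "unit_vec _"])
  ultimately have "S \<subseteq> \<phi> ` V"
    using hull_minimal gens_minimal by (metis minimal_generating_def)
  with assms show thesis using that by auto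
qed

section \<open>Apery elements and their factorizations\<close>

lemma Ap_iff: "s \<in> S \<Longrightarrow> s \<notin> Ap \<longleftrightarrow> (\<exists>t\<in>S. s = m + t)"
  by (auto simp: Apery_def) (metis le_add_diff_inverse)

text \<open>Outside \<open>Ap\<close>, the semigroup is the ideal \<open>m + S\<close>. Hence
  \<open>Ap\<close> is closed under taking summands in \<open>S\<close>, which makes the vectors of
  Apery degree an order ideal.\<close>

lemma Ap_addD:
  assumes "x + y \<in> Ap" "x \<in> S" "y \<in> S"
  shows "x \<in> Ap"
proof (rule ccontr)
  assume "x \<notin> Ap"
  then obtain t where "t \<in> S" "x = m + t" using Ap_iff assms by auto
  then have "x + y \<notin> Ap" using Ap_iff[of "x + y"] S_add assms by (metis add.assoc)
  with assms show False by simp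
qed

lemma zero_in_Ap: "0 \<in> Ap"
  using m_pos by (auto simp: Apery_def zero_in_S)

lemma phi_S_Ap_0:
  assumes "z \<in> V" "\<phi> z \<in> Ap"
  shows "z \<in> W"
proof (rule ccontr)
  assume "z \<notin> W"
  then have "0 \<in> supp z" using assms V_in_W_iff by (auto simp: supp_def)
  then obtain v where v: "z = v + unit_vec 0" by (rule in_suppE)
  have "\<phi> v \<in> S" using v assms by (intro phi_S_in) auto
  then show False using assms(2) v by (auto simp: Apery_def)
qed

lemma n_in_Ap:
  assumes i: "i \<in> {1..k}"
  shows "n i \<in> Ap"
proof (rule ccontr)
  define A where "A = insert m (n ` {1..k})"
  define H where "H = submonoid hull (A - {n i})"
  have H: "submonoid H" unfolding H_def by (rule hull_in) (auto simp: submonoid_def)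
  assume "n i \<notin> Ap"
  then obtain t where t: "t \<in> S" "n i = m + t" using Ap_iff[OF n_in[OF i]] by auto
  then obtain z where z: "z \<in> V" "\<phi> z = t" using S_factorization by metis
  have mH: "m \<in> H" unfolding H_def A_def using n_gt[OF i] by (intro hull_inc) auto
  \<comment> \<open>A factorization of an element below \<open>n i\<close> cannot use
    \<open>n i\<close>. So \<open>t = n i - m\<close> lies in the submonoid \<open>H\<close>
    generated by the other generators, and with it \<open>n i\<close>.\<close>
  have "\<phi> z < n i \<Longrightarrow> \<phi> z \<in> H" using z(1)
  proof (induction z rule: vecs_induct)
    case (add w j)
    have "\<phi> (unit_vec j) \<in> H"
    proof (cases "j = 0")
      case False
      then have "n j \<in> A - {n i}" using add by (auto simp: A_def)
      then have "n j \<in> H" by (simp add: H_def hull_inc)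
      then show ?thesis using False add by simp
    qed (simp add: mH)
    then show ?case using add H by (simp add: submonoid_def)
  qed (use H in \<open>auto simp: submonoid_def\<close>)
  then have "n i \<in> H" using t z m_pos mH H by (simp add: submonoid_def)
  then show False
    using minimal_generating_irredundant[OF gens_minimal, of "n i"] i by (simp add: H_def A_def)
qed


subsection \<open>The Kunz nilsemigroup as a quotient of the semigroup\<close>

text \<open>On \<open>S\<close> this is the Rees quotient map by the ideal \<open>m + S\<close>; an
  Apery element is determined by its residue.\<close>

definition nil_class :: "nat \<Rightarrow> nat option" where
  "nil_class s = (if s \<in> Ap then Some (s mod m) else None)"

lemma apery_elt_mod:
  assumes "s \<in> Ap" shows "apery_elt S (s mod m) = s"
  using Apery_unique[OF num apery_elt(1)[OF num] assms] apery_elt(2)[OF num, of "s mod m"] by simp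

text \<open>For Apery elements, the test in \<open>kunz_add\<close> asks whether
  \<open>x + y\<close> is the Apery element of its own class, that is, whether it lies in
  \<open>Ap\<close>. If a summand is in the ideal, so is the sum.\<close>

lemma kunz_add_nil_class:
  assumes "x \<in> S" "y \<in> S"
  shows "kunz_add S (nil_class x) (nil_class y) = nil_class (x + y)"
proof (cases "x \<in> Ap \<and> y \<in> Ap")
  case True
  then have "kunz_add S (nil_class x) (nil_class y) =
    (if x + y = apery_elt S ((x + y) mod m) then Some ((x + y) mod m) else None)"
    by (simp add: nil_class_def apery_elt_mod mod_add_eq)
  moreover have "x + y = apery_elt S ((x + y) mod m) \<longleftrightarrow> x + y \<in> Ap"
    using apery_elt_mod apery_elt(1)[OF num] by metis
  ultimately show ?thesis by (simp add: nil_class_def)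
next
  case False
  moreover have "x + y \<notin> Ap"
    using False Ap_addD[of x y] Ap_addD[of y x] assms by (auto simp: add.commute)
  ultimately show ?thesis by (cases "nil_class x") (auto simp: nil_class_def)
qed

lemma nil_class_n: "i \<in> {1..k} \<Longrightarrow> nil_class (n i) = Some (atom S n i)"
  by (simp add: nil_class_def n_in_Ap atom_def)

lemma nil_class_0: "nil_class 0 = Some 0"
  by (simp add: nil_class_def zero_in_Ap)

lemma S_mult: "x \<in> S \<Longrightarrow> c * x \<in> S"
  by (induction c) (auto simp: zero_in_S intro: S_add)

lemma kunz_scale_nil_class:
  assumes "x \<in> S" shows "kunz_scale S c (nil_class x) = nil_class (c * x)"
  by (induction c) (auto simp: kunz_scale_def nil_class_0 kunz_add_nil_class S_mult assms)

text \<open>Membership in \<open>S\<close> is carried through the induction because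
  \<open>kunz_add_nil_class\<close> asks for it at each step.\<close>

lemma foldr_kunz:
  assumes "set is \<subseteq> {1..k}"
  shows "foldr (\<lambda>i. kunz_add S (kunz_scale S (w i) (Some (atom S n i)))) is (Some 0)
      = nil_class (\<Sum>i\<leftarrow>is. w i * n i) \<and> (\<Sum>i\<leftarrow>is. w i * n i) \<in> S"
  using assms
proof (induction "is")
  case (Cons i "is")
  then have i: "i \<in> {1..k}" by simp
  then show ?case
    using Cons by (auto simp: kunz_add_nil_class kunz_scale_nil_class S_mult n_in S_add
        simp flip: nil_class_n[OF i])
qed (auto simp: nil_class_0 zero_in_S)

lemma phi_P_eq: "w \<in> W \<Longrightarrow> \<psi> w = nil_class (\<phi> w)"
proof -
  assume w: "w \<in> W"
  have "(\<Sum>i\<leftarrow>[1..<Suc k]. w i * n i) = (\<Sum>i=1..k. w i * n i)"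
    by (metis atLeastLessThanSuc_atLeastAtMost distinct_upt set_upt sum.distinct_set_conv_list)
  also have "\<dots> = \<phi> w" using w by (auto simp: phi_S_def vecs_def)
  finally have "(\<Sum>i\<leftarrow>[1..<Suc k]. w i * n i) = \<phi> w" .
  moreover have "set [1..<Suc k] \<subseteq> {1..k}" by auto
  ultimately show ?thesis using w foldr_kunz[of "[1..<Suc k]" w] unfolding phi_P_def by metis
qed

lemma phi_P_None_iff: "w \<in> W \<Longrightarrow> \<psi> w = None \<longleftrightarrow> \<phi> w \<notin> Ap"
  by (simp add: phi_P_eq nil_class_def)

lemma phi_P_Some_eq_iff:
  assumes "w \<in> W" "s \<in> Ap"
  shows "\<psi> w = Some (s mod m) \<longleftrightarrow> \<phi> w = s"
  using assms Apery_unique[OF num, of "\<phi> w" s] by (auto simp: phi_P_eq nil_class_def)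

text \<open>The right-hand side may range over \<open>V\<close> because no factorization of an Apery
  element involves \<open>m\<close>.\<close>

lemma Z_P_Some:
  assumes "s \<in> Ap"
  shows "Z_P S k n (Some (s mod m)) = {w \<in> V. \<phi> w = s}"
  using assms phi_P_Some_eq_iff phi_S_Ap_0 W_subset_V by (auto simp: Z_P_def)

lemma phi_P_eq_iff:
  assumes "w \<in> W" "w' \<in> W" "\<psi> w \<noteq> None"
  shows "\<psi> w = \<psi> w' \<longleftrightarrow> \<phi> w = \<phi> w'"
  using assms Apery_unique[OF num, of "\<phi> w" "\<phi> w'"]
  by (auto simp: phi_P_eq nil_class_def split: if_splits)

lemma congruence_ker_S: "congruence V (ker_on V \<phi>)"
  by (rule congruence_ker_on) auto

lemma congruence_ker_P: "congruence W (ker_on W \<psi>)"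
proof (rule congruence_ker_on)
  fix x y u assume "x \<in> W" "y \<in> W" "u \<in> W" "\<psi> x = \<psi> y"
  then show "\<psi> (x + u) = \<psi> (y + u)"
    using W_subset_V by (simp add: phi_P_eq phi_S_in subset_iff flip: kunz_add_nil_class)
qed auto

subsection \<open>The minimal presentation of the Kunz poset\<close>

text \<open>An Apery element that is at least \<open>m\<close> exceeds a gap by \<open>m\<close>, so
  \<open>Ap\<close> is bounded. Each coordinate is at most the value, as the generators are
  positive.\<close>

lemma finite_factorizations: "finite {w \<in> W. \<phi> w \<in> Ap}"
proof -
  obtain b where b: "\<And>x. x \<notin> S \<Longrightarrow> x < b"
    using num unfolding numerical_semigroup_def by (metis ComplI finite_nat_set_iff_bounded)
  have Ap: "x \<le> m + b" if "x \<in> Ap" for x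
  proof (rule ccontr)
    assume "\<not> x \<le> m + b"
    then have "m \<le> x" "\<not> x - m < b" by auto
    then have "m \<le> x" "x - m \<in> S" using b by blast+
    then show False using that by (simp add: Apery_def)
  qed
  have "w i \<le> \<phi> w" if "i \<in> {1..k}" for w i
  proof -
    have "w i \<le> w i * n i" using n_gt[OF that] by simp
    also have "\<dots> \<le> (\<Sum>i=1..k. w i * n i)" by (rule member_le_sum) (use that in auto)
    finally show ?thesis by (simp add: phi_S_def)
  qed
  then have "w i \<le> m + b" if "\<phi> w \<in> Ap" "i \<in> {1..k}" for w i
    using Ap[OF that(1)] that(2) le_trans by blast
  then have "{w \<in> W. \<phi> w \<in> Ap} \<subseteq>
      {w. \<forall>i. (i \<in> {1..k} \<longrightarrow> w i \<in> {..m + b}) \<and> (i \<notin> {1..k} \<longrightarrow> w i = 0)}"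
    by (auto simp: vecs_def)
  then show ?thesis
    by (rule finite_subset) (intro finite_set_of_finite_funs finite_atLeastAtMost finite_atMost)
qed

text \<open>The ideal of factorizations of the absorbing element is generated by its elements that are
  one atom away from a factorization of a residue, and these are finite in number.\<close>

lemma finite_generation_None:
  obtains \<tau> where "finite \<tau>" "\<tau> \<subseteq> Z_P S k n None \<times> Z_P S k n None"
    "Z_P S k n None \<times> Z_P S k n None \<subseteq> congruence W hull \<tau>"
proof -
  define Z where "Z = Z_P S k n None"
  have Z_iff: "w \<in> Z \<longleftrightarrow> w \<in> W \<and> \<phi> w \<notin> Ap" for w
    by (auto simp: Z_def Z_P_def phi_P_None_iff)
  have Z_add: "w + u \<in> Z" if "w \<in> Z" "u \<in> W" for w u
  proof -
    have "\<phi> w \<in> S" "\<phi> u \<in> S" using that W_subset_V Z_iff phi_S_in by blast+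
    then show ?thesis using that Ap_addD[of "\<phi> w" "\<phi> u"] by (auto simp: Z_iff)
  qed
  show thesis
  proof (cases "Z = {}")
    \<comment> \<open>This occurs for \<open>k = 0\<close>, where 0 is the only vector.\<close>
    case True
    with that[of "{}"] show thesis by (simp add: Z_def)
  next
    case False
    define F where "F = (\<Union>i\<in>{1..k}. (\<lambda>w. w + unit_vec i) ` {w \<in> W. \<phi> w \<in> Ap}) \<inter> Z"
    have "finite F" unfolding F_def using finite_factorizations by blast
    have F: "w \<in> Z \<Longrightarrow> \<exists>f\<in>F. \<exists>u\<in>W. w = f + u" if "w \<in> W" for w
      using that
    proof (induction w rule: vecs_induct)
      case zero
      then show ?case by (simp add: Z_iff zero_in_Ap)
    next
      case (add w i)
      have e: "unit_vec i \<in> W" using add.hyps by simp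
      show ?case
      proof (cases "w \<in> Z")
        case True
        then obtain f u where fu: "f \<in> F" "u \<in> W" "w = f + u" using add.IH by blast
        then have "w + unit_vec i = f + (u + unit_vec i)" by (simp add: add.assoc)
        moreover have "u + unit_vec i \<in> W" using fu e by simp
        ultimately show ?thesis using fu by blast
      next
        case False
        then have "\<phi> w \<in> Ap" using add.hyps Z_iff by blast
        then have "w + unit_vec i \<in> F" unfolding F_def using add by blast
        then show ?thesis by (intro bexI[of _ "w + unit_vec i"] bexI[of _ 0]) auto
      qed
    qed
    obtain w where w: "w \<in> Z" using False by blast
    \<comment> \<open>A star around the base point \<open>w\<close>, reaching all of
      \<open>F\<close> and the translates of \<open>w\<close> by one atom. The translates relate
      \<open>w\<close> to every \<open>w + u\<close>; together with the pair of \<open>w\<close> and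
      \<open>f\<close> this reaches every \<open>f + u\<close>.\<close>
    define \<tau> where "\<tau> = Pair w ` F \<union> (\<lambda>i. (w, w + unit_vec i)) ` {1..k}"
    define H where "H = congruence W hull \<tau>"
    have \<tau>: "\<tau> \<subseteq> Z \<times> Z" unfolding \<tau>_def F_def using w Z_add by auto
    then have H: "congruence W H"
      unfolding H_def by (intro congruence_hull) (auto simp: Z_iff)
    have \<tau>H: "p \<in> \<tau> \<Longrightarrow> p \<in> H" for p unfolding H_def by (rule hull_inc)
    have 1: "(w, w + u) \<in> H" if "u \<in> W" for u
      using that
    proof (induction u rule: vecs_induct)
      case zero
      then show ?case using congruenceD(2)[OF H] w by (simp add: Z_iff)
    next
      case (add u i)
      then have "unit_vec i \<in> W" by simp
      with add have "(w + unit_vec i, w + u + unit_vec i) \<in> H"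
        by (intro congruenceD(5)[OF H])
      moreover have "(w, w + unit_vec i) \<in> H" using add by (intro \<tau>H) (simp add: \<tau>_def)
      ultimately show ?case using congruenceD(4)[OF H] by (metis add.assoc)
    qed
    have 2: "(w, v) \<in> H" if v: "v \<in> Z" for v
    proof -
      obtain f u where fu: "f \<in> F" "u \<in> W" "v = f + u" using F[of v] v Z_iff[of v] by blast
      then have "(w, f) \<in> H" by (intro \<tau>H) (simp add: \<tau>_def)
      then have "(w + u, v) \<in> H" using fu congruenceD(5)[OF H] by blast
      then show ?thesis using 1[OF fu(2)] congruenceD(4)[OF H] by blast
    qed
    have "Z \<times> Z \<subseteq> H" using 2 congruenceD(3,4)[OF H] by blast
    moreover have "finite \<tau>" using \<open>finite F\<close> by (simp add: \<tau>_def)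
    ultimately show thesis using that \<tau> by (simp add: Z_def H_def)
  qed
qed

end

section \<open>Relations of Apery degree\<close>

locale kunz_presentation = kunz +
  fixes \<rho> :: "((nat \<Rightarrow> nat) \<times> (nat \<Rightarrow> nat)) set"
  assumes presentation: "minimal_presentation_S S k n \<rho>" and centric: "m_centric S k n \<rho>"
begin

lemma minimal_generating: "minimal_generating (congruence V) \<rho> (ker_on V \<phi>)"
  using presentation by (simp add: minimal_presentation_S_def)

lemma hull_rho: "congruence V hull \<rho> = ker_on V \<phi>"
  using minimal_generating by (simp add: minimal_generating_def)

lemma rho_subset: "\<rho> \<subseteq> ker_on V \<phi>"
  using hull_rho hull_subset by metis

lemma rhoD: "(z, z') \<in> \<rho> \<Longrightarrow> z \<in> V \<and> z' \<in> V \<and> \<phi> z = \<phi> z'"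
  using rho_subset by (auto simp: ker_on_def)

lemma irredundant: "p \<in> \<rho> \<Longrightarrow> p \<notin> congruence V hull (\<rho> - {p})"
  using minimal_generating by (rule minimal_generating_irredundant)

lemma congruence_hull_rho: "congruence V (congruence V hull (\<rho> - X))"
  by (rule congruence_hull) (use rhoD in auto)

lemma hat_eq: "z 0 = 0 \<Longrightarrow> hat z = z"
  by (auto simp: hat_def)

lemma hat_in_W: "z \<in> V \<Longrightarrow> hat z \<in> W"
  by (auto simp: hat_def vecs_def)

text \<open>Being m-centric enters here: if \<open>z 0 = 0\<close>, then \<open>z\<close> is its own
  hat, whose value in the nilsemigroup is not infinity. Conversely, Apery elements have no
  factorization involving \<open>m\<close>.\<close>

lemma rho_Ap_iff:
  assumes "(z, z') \<in> \<rho>"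
  shows "\<phi> z \<in> Ap \<longleftrightarrow> z 0 = 0"
proof
  show "z 0 = 0" if "\<phi> z \<in> Ap"
    using phi_S_Ap_0[OF _ that] rhoD[OF assms] by (auto simp: vecs_def)
  have "\<psi> (hat z) \<noteq> None" using assms centric by (auto simp: m_centric_def Z_P_def)
  then show "\<phi> z \<in> Ap" if "z 0 = 0"
    using that rhoD[OF assms] hat_in_W phi_P_None_iff by (metis hat_eq)
qed

definition Ap_relations where
  "Ap_relations = {(z, z') \<in> \<rho>. \<phi> z \<in> Ap}"

text \<open>In Apery degree neither side of a relation involves \<open>m\<close>, so the hats change
  nothing.\<close>

lemma hat_Ap_relations: "{(hat z, hat z') | z z'. (z, z') \<in> \<rho> \<and> z 0 = 0} = Ap_relations"
proof -
  have "hat z = z \<and> hat z' = z'" if "(z, z') \<in> \<rho>" "z 0 = 0" for z z'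
  proof -
    have "z' \<in> W" using that rho_Ap_iff rhoD by (metis phi_S_Ap_0)
    then show ?thesis using that hat_eq by (auto simp: vecs_def)
  qed
  then show ?thesis unfolding Ap_relations_def using rho_Ap_iff by (auto; metis)
qed

lemma Ap_relations_in_W: "(z, z') \<in> Ap_relations \<Longrightarrow> z \<in> W \<and> z' \<in> W"
  using rhoD[of z z'] phi_S_Ap_0[of z] phi_S_Ap_0[of z'] by (auto simp: Ap_relations_def)

lemma Ap_relations_subset: "Ap_relations \<subseteq> ker_on W \<psi>"
proof -
  have "(z, z') \<in> ker_on W \<psi>" if "(z, z') \<in> Ap_relations" for z z'
    using Ap_relations_in_W[OF that] that rhoD[of z z']
    by (auto simp: ker_on_def phi_P_eq Ap_relations_def)
  then show ?thesis by auto
qed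

text \<open>The vectors of Apery degree form an order ideal inside \<open>W\<close>, so
  \<open>congruence_hull_restrict\<close> turns a derivation from \<open>\<rho>\<close> over
  \<open>V\<close> into one over \<open>W\<close> that uses only relations of Apery degree.\<close>

lemma ker_P_generated:
  assumes "(x, y) \<in> ker_on W \<psi>" "\<psi> x \<noteq> None"
  shows "(x, y) \<in> congruence W hull Ap_relations"
proof (rule congruence_hull_restrict[OF congruence_ker_S rho_subset,
      where G = "{w \<in> W. \<phi> w \<in> Ap}"])
  have xy: "x \<in> W" "y \<in> W" "\<psi> x = \<psi> y" using assms by (auto simp: ker_on_def)
  then have "\<phi> x = \<phi> y" using phi_P_eq_iff[of x y] assms by blast
  then show "(x, y) \<in> congruence V hull \<rho>" using xy W_subset_V by (auto simp: hull_rho ker_on_def)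
  show "x \<in> {w \<in> W. \<phi> w \<in> Ap}" using xy(1) assms(2) phi_P_None_iff[OF xy(1)] by simp
next
  fix x u assume "x \<in> V" "u \<in> V" "x + u \<in> {w \<in> W. \<phi> w \<in> Ap}"
  then show "x \<in> {w \<in> W. \<phi> w \<in> Ap} \<and> u \<in> W"
    using Ap_addD[of "\<phi> x" "\<phi> u"] phi_S_in by auto
qed (use Ap_relations_in_W phi_S_Ap_0 in \<open>auto simp: Ap_relations_def\<close>)

text \<open>The transfer in the other direction: if \<open>p\<close> were missing from
  \<open>B\<close>, a derivation of \<open>p\<close> from \<open>B\<close> over \<open>W\<close>
  would stay away from infinity and give a derivation over \<open>V\<close> from
  \<open>\<rho> - {p}\<close>.\<close>

lemma Ap_relation_needed:
  assumes B: "congruence W hull B = ker_on W \<psi>"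
    and p: "p \<in> Ap_relations" and B': "\<And>w w'. (w, w') \<in> B \<Longrightarrow> \<psi> w \<noteq> None \<Longrightarrow> (w, w') \<in> \<rho>"
  shows "p \<in> B"
proof (rule ccontr)
  assume "p \<notin> B"
  obtain z z' where z: "p = (z, z')" by force
  have "B \<subseteq> ker_on W \<psi>" using B hull_subset by metis
  then have "(z, z') \<in> congruence V hull (\<rho> - {p})"
  proof (rule congruence_hull_restrict[OF congruence_ker_P, where G = "{w \<in> W. \<psi> w \<noteq> None}"])
    show "(z, z') \<in> congruence W hull B"
      using B Ap_relations_subset p z by auto
    show "z \<in> {w \<in> W. \<psi> w \<noteq> None}"
      using p Ap_relations_in_W z phi_P_None_iff[of z] by (auto simp: Ap_relations_def)
    show "\<rho> - {p} \<subseteq> V \<times> V" using rhoD by auto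
    show "(x, y) \<in> \<rho> - {p}" if "(x, y) \<in> B" "x \<in> {w \<in> W. \<psi> w \<noteq> None}" for x y
      using that B' \<open>p \<notin> B\<close> by auto
  next
    fix x u assume xu: "x \<in> W" "u \<in> W" "x + u \<in> {w \<in> W. \<psi> w \<noteq> None}"
    then have "\<phi> x \<in> S" "\<phi> u \<in> S" "\<phi> x + \<phi> u \<in> Ap"
      using W_subset_V phi_S_in phi_P_None_iff[of "x + u"] by auto
    then show "x \<in> {w \<in> W. \<psi> w \<noteq> None} \<and> u \<in> V"
      using xu W_subset_V Ap_addD phi_P_None_iff[of x] by auto
  qed (use W_subset_V in auto)
  then show False using irredundant p z by (auto simp: Ap_relations_def)
qed

text \<open>A minimal generating set of the whole kernel must be exhibited, so relations at infinity
  are added: an inclusion-minimal \<open>t\<close> inside the finite \<open>\<tau>\<close> that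
  completes \<open>Ap_relations\<close>.\<close>

lemma minimal_presentation_P: "minimal_presentation_P S k n Ap_relations"
proof -
  define Z where "Z = Z_P S k n None"
  define gen where "gen = (\<lambda>t. congruence W hull (Ap_relations \<union> t) = ker_on W \<psi>)"
  obtain \<tau> where \<tau>: "finite \<tau>" "\<tau> \<subseteq> Z \<times> Z" "Z \<times> Z \<subseteq> congruence W hull \<tau>"
    using finite_generation_None unfolding Z_def by metis
  have "gen \<tau>" unfolding gen_def
  proof
    have "\<tau> \<subseteq> ker_on W \<psi>" using \<tau> by (force simp: Z_def Z_P_def ker_on_def)
    then show "congruence W hull (Ap_relations \<union> \<tau>) \<subseteq> ker_on W \<psi>"
      using Ap_relations_subset congruence_ker_P by (intro hull_minimal) auto
    show "ker_on W \<psi> \<subseteq> congruence W hull (Ap_relations \<union> \<tau>)"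
    proof
      fix p assume p: "p \<in> ker_on W \<psi>"
      have "p \<in> congruence W hull Ap_relations \<or> p \<in> congruence W hull \<tau>"
      proof (cases "\<psi> (fst p) = None")
        case True
        then have "p \<in> Z \<times> Z" using p by (auto simp: Z_def Z_P_def ker_on_def)
        then show ?thesis using \<tau>(3) by blast
      next
        case False
        then show ?thesis using p ker_P_generated[of "fst p" "snd p"] by simp
      qed
      then show "p \<in> congruence W hull (Ap_relations \<union> \<tau>)"
        by (metis Un_upper1 Un_upper2 hull_mono subsetD)
    qed
  qed
  define T where "T = {t. t \<subseteq> \<tau> \<and> gen t}"
  have "finite T" "T \<noteq> {}"
    using \<tau>(1) \<open>gen \<tau>\<close> by (auto simp: T_def)
  then obtain t where "t \<in> T" and t_min: "\<forall>t'\<in>T. t' \<subseteq> t \<longrightarrow> t = t'"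
    using finite_has_minimal by metis
  then have t: "t \<subseteq> \<tau>" "gen t" by (simp_all add: T_def)
  have t_None: "\<psi> w = None" if "(w, w') \<in> t" for w w'
    using that t(1) \<tau>(2) by (auto simp: Z_def Z_P_def)
  have rel: "\<psi> w \<noteq> None" "(w, w') \<in> \<rho>" if "(w, w') \<in> Ap_relations" for w w'
    using that Ap_relations_in_W[OF that] phi_P_None_iff[of w] by (auto simp: Ap_relations_def)
  have "minimal_generating (congruence W) (Ap_relations \<union> t) (ker_on W \<psi>)"
    unfolding minimal_generating_def
  proof (intro conjI allI impI notI)
    show "congruence W hull (Ap_relations \<union> t) = ker_on W \<psi>" using t(2) by (simp add: gen_def)
    fix B assume B: "B \<subset> Ap_relations \<union> t" "congruence W hull B = ker_on W \<psi>"
    have BD: "(w, w') \<in> \<rho>" if "(w, w') \<in> B" "\<psi> w \<noteq> None" for w w'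
    proof -
      have "(w, w') \<in> Ap_relations \<or> (w, w') \<in> t" using that(1) B(1) by auto
      then show ?thesis using t_None[of w w'] rel(2)[of w w'] that(2) by auto
    qed
    have "Ap_relations \<subseteq> B" by (rule subsetI) (rule Ap_relation_needed[OF B(2) _ BD])
    then have "B = Ap_relations \<union> (B \<inter> t)" using B(1) by blast
    then have "gen (B \<inter> t)" using B(2) by (simp add: gen_def)
    then have "B \<inter> t \<in> T" using t(1) by (auto simp: T_def)
    then have "t = B \<inter> t" using t_min by blast
    with \<open>Ap_relations \<subseteq> B\<close> B(1) show False by blast
  qed
  moreover have "Ap_relations = {(w, w') \<in> Ap_relations \<union> t. \<psi> w \<noteq> None}"
  proof (rule set_eqI)
    fix p
    show "p \<in> Ap_relations \<longleftrightarrow> p \<in> {(w, w') \<in> Ap_relations \<union> t. \<psi> w \<noteq> None}"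
      by (cases p) (use t_None[of "fst p" "snd p"] rel(1)[of "fst p" "snd p"] in auto)
  qed
  ultimately show ?thesis unfolding minimal_presentation_P_def by blast
qed


subsection \<open>Outer Betti elements\<close>

text \<open>Removing a shared atom leaves a pair of lower degree, so only generators of lower degree are
  used to relate it.\<close>

lemma shared_atom_related:
  assumes r: "(z, z') \<in> \<rho>" and xy: "x \<in> V" "y \<in> V" "\<phi> x = \<phi> z" "\<phi> y = \<phi> z"
    and i: "i \<in> supp x" "i \<in> supp y"
  shows "(x, y) \<in> congruence V hull (\<rho> - {(z, z')})"
proof -
  obtain x' where x': "x = x' + unit_vec i" using i(1) by (rule in_suppE)
  obtain y' where y': "y = y' + unit_vec i" using i(2) by (rule in_suppE)
  have e: "unit_vec i \<in> V" "0 < \<phi> (unit_vec i)"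
    using supp_subset[OF xy(1)] i(1) phi_S_unit_vec_pos[of i] by auto
  have "(x', y') \<in> congruence V hull (\<rho> - {(z, z')})"
  proof (rule congruence_hull_restrict[OF congruence_ker_S rho_subset,
        where G = "{w \<in> V. \<phi> w < \<phi> z}"])
    show "(x', y') \<in> congruence V hull \<rho>"
      using xy x' y' by (auto simp: hull_rho ker_on_def)
    show "x' \<in> {w \<in> V. \<phi> w < \<phi> z}" using xy x' e by auto
    show "\<rho> - {(z, z')} \<subseteq> V \<times> V" using rhoD by auto
  qed auto
  then show ?thesis unfolding x' y' using e by (intro congruenceD(5)[OF congruence_hull_rho])
qed

text \<open>Each edge joins two factorizations sharing an atom, so a path composes such pairs. A
  relation whose two ends lie in one component is therefore redundant.\<close>

lemma connected_related:
  assumes r: "(z, z') \<in> \<rho>" and B: "B \<subseteq> {w \<in> V. \<phi> w = \<phi> z}"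
    and xy: "(x, y) \<in> (nabla B)\<^sup>*" "x \<in> B"
  shows "(x, y) \<in> congruence V hull (\<rho> - {(z, z')})"
  using xy
proof (induction rule: rtrancl_induct)
  case base
  then show ?case using B congruenceD(2)[OF congruence_hull_rho] by blast
next
  case (step y w)
  then obtain i where "y \<in> B" "w \<in> B" "i \<in> supp y" "i \<in> supp w" by (auto simp: nabla_def)
  then have "(y, w) \<in> congruence V hull (\<rho> - {(z, z')})"
    using B by (intro shared_atom_related[OF r]) auto
  then show ?case using step congruenceD(4)[OF congruence_hull_rho] by blast
qed

text \<open>If \<open>m\<close> occurs in \<open>z'\<close>, the degree is not Apery, so
  \<open>m\<close> occurs in \<open>z\<close> as well. The two sides then share \<open>m\<close>,
  and the relation is redundant.\<close>

lemma target_0: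
  assumes r: "(z, z') \<in> \<rho>"
  shows "z' 0 = 0"
proof (rule ccontr)
  assume "z' 0 \<noteq> 0"
  have z: "z \<in> V" "z' \<in> V" "\<phi> z = \<phi> z'" using rhoD[OF r] by auto
  show False
  proof (cases "z 0 = 0")
    case True
    then have "z' \<in> W" using rho_Ap_iff[OF r] z phi_S_Ap_0[of z'] by simp
    then show False using \<open>z' 0 \<noteq> 0\<close> by (simp add: vecs_def)
  next
    case False
    then have "(z, z') \<in> congruence V hull (\<rho> - {(z, z')})"
      using z \<open>z' 0 \<noteq> 0\<close> by (intro shared_atom_related[OF r, where i = 0]) (auto simp: supp_def)
    then show False using irredundant[OF r] by simp
  qed
qed

section \<open>Outer Betti elements as components of factorization graphs\<close>

lemma outer_betti_remove_atom:
  assumes "outer_betti S k n B" "w \<in> B" "i \<in> supp w"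
  obtains s where "remove_atom B i = {v \<in> V. \<phi> v = s}"
proof -
  obtain p where p: "p < m" "remove_atom B i = Z_P S k n (Some p)"
    using assms unfolding outer_betti_def by blast
  then show thesis
    using that Z_P_Some[OF apery_elt(1)[OF num, of p]] apery_elt(2)[OF num, of p] by simp
qed

lemma outer_betti_in:
  assumes "outer_betti S k n B" "w \<in> B"
  shows "w \<in> W" "w \<in> V" "\<phi> w \<notin> Ap"
proof -
  have "w \<in> Z_P S k n None" using assms by (auto simp: outer_betti_def)
  then show "w \<in> W" "\<phi> w \<notin> Ap" using phi_P_None_iff[of w] by (auto simp: Z_P_def)
  then show "w \<in> V" using W_subset_V by auto
qed

text \<open>Removing \<open>i\<close> yields all factorizations of one element, so \<open>B\<close>
  contains every factorization of the degree of \<open>w\<close> that uses \<open>i\<close>. Thus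
  \<open>B\<close> is closed under sharing an atom within a degree.\<close>

lemma outer_betti_adjacent:
  assumes B: "outer_betti S k n B" "w \<in> B" "i \<in> supp w"
    and w': "w' \<in> V" "i \<in> supp w'"
  shows "w' \<in> B \<longleftrightarrow> \<phi> w' = \<phi> w"
proof -
  obtain s where s: "remove_atom B i = {v \<in> V. \<phi> v = s}" by (rule outer_betti_remove_atom[OF B])
  obtain v where v: "w = v + unit_vec i" using B(3) by (rule in_suppE)
  obtain v' where v': "w' = v' + unit_vec i" using w'(2) by (rule in_suppE)
  have "v \<in> remove_atom B i" using B v by (simp add: remove_atom_iff)
  then have "\<phi> v = s" using s by auto
  moreover have "w' \<in> B \<longleftrightarrow> v' \<in> remove_atom B i" using v' by (simp add: remove_atom_iff)
  ultimately show ?thesis using s v v' w' by auto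
qed

text \<open>Neighbours have equal degree, and connectedness spreads this over all of
  \<open>B\<close>.\<close>

lemma outer_betti_degree:
  assumes B: "outer_betti S k n B" "w \<in> B" "w' \<in> B"
  shows "\<phi> w' = \<phi> w"
proof -
  have "(w, w') \<in> (nabla B)\<^sup>*" using B by (auto simp: outer_betti_def nabla_connected_def)
  then show ?thesis
  proof (induction rule: rtrancl_induct)
    case (step x y)
    then obtain i where "x \<in> B" "y \<in> B" "i \<in> supp x" "i \<in> supp y" by (auto simp: nabla_def)
    then have "\<phi> y = \<phi> x"
      using outer_betti_adjacent[OF B(1)] outer_betti_in[OF B(1)] by blast
    with step show ?case by simp
  qed simp
qed

text \<open>The witness is the component of \<open>z'\<close> in the factorization graph of its
  degree. Irredundancy keeps \<open>z\<close> out of it, and since \<open>m\<close> occurs in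
  \<open>z\<close>, no element of this component involves \<open>m\<close>.\<close>

lemma outer_betti_of_relation:
  assumes r: "(z, z') \<in> \<rho>" and z0: "0 < z 0"
  shows "\<exists>B. outer_betti S k n B \<and> z' \<in> B"
proof -
  define F where "F = {w \<in> V. \<phi> w = \<phi> z}"
  define B where "B = {w \<in> F. (z', w) \<in> (nabla F)\<^sup>*}"
  have z: "z \<in> V" "z' \<in> V" "\<phi> z = \<phi> z'" using rhoD[OF r] by auto
  then have zF: "z \<in> F" "z' \<in> F" by (auto simp: F_def)
  have closed: "w' \<in> B" if "w \<in> B" "w' \<in> F" "i \<in> supp w" "i \<in> supp w'" for w w' i
  proof -
    have "(w, w') \<in> nabla F" using that by (auto simp: nabla_def B_def)
    then show ?thesis using that by (auto simp: B_def)
  qed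
  have "z \<notin> B"
  proof
    assume "z \<in> B"
    then have "(z', z) \<in> congruence V hull (\<rho> - {(z, z')})"
      using zF by (intro connected_related[OF r, of F]) (auto simp: F_def B_def)
    then show False using irredundant[OF r] congruenceD(3)[OF congruence_hull_rho] by blast
  qed
  then have B0: "w 0 = 0" if "w \<in> B" for w
    using closed[OF that zF(1), of 0] z0 by (auto simp: supp_def)
  then have BW: "B \<subseteq> W" using V_in_W_iff by (auto simp: B_def F_def)
  have nAp: "\<phi> z \<notin> Ap" using rho_Ap_iff[OF r] z0 by simp
  have "outer_betti S k n B"
    unfolding outer_betti_def
  proof (intro conjI ballI)
    show "B \<subseteq> Z_P S k n None"
      using BW nAp phi_P_None_iff by (auto simp: Z_P_def B_def F_def)
    fix i assume "i \<in> (\<Union>w\<in>B. supp w)"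
    then obtain w where w: "w \<in> B" "i \<in> supp w" by blast
    obtain v where v: "w = v + unit_vec i" using w(2) by (rule in_suppE)
    have "w \<in> V" "\<phi> w = \<phi> z" using w by (auto simp: B_def F_def)
    with v have v': "v \<in> V" "unit_vec i \<in> V" "\<phi> v + \<phi> (unit_vec i) = \<phi> z" by auto
    \<comment> \<open>Otherwise \<open>v\<close> could be exchanged for a factorization involving
      \<open>m\<close>; keeping the atom \<open>i\<close>, the result would be a neighbour of
      \<open>w\<close>, hence in \<open>B\<close>.\<close>
    have "\<phi> v \<in> Ap"
    proof (rule ccontr)
      assume "\<phi> v \<notin> Ap"
      then obtain t where t: "t \<in> S" "\<phi> v = m + t" using Ap_iff phi_S_in v' by blast
      then obtain y where y: "y \<in> V" "\<phi> y = t" using S_factorization by metis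
      have "y + unit_vec 0 + unit_vec i \<in> F" using y t v' by (simp add: F_def)
      then have "y + unit_vec 0 + unit_vec i \<in> B" using closed[OF w(1) _ w(2)] by simp
      then have "(y + unit_vec 0 + unit_vec i) 0 = 0" by (rule B0)
      then show False by (simp add: plus_fun_apply unit_vec_def)
    qed
    moreover have "remove_atom B i = {x \<in> V. \<phi> x = \<phi> v}"
    proof (intro set_eqI)
      fix x
      have "x + unit_vec i \<in> B \<longleftrightarrow> x + unit_vec i \<in> F"
        using closed[OF w(1) _ w(2)] by (auto simp: B_def)
      then show "x \<in> remove_atom B i \<longleftrightarrow> x \<in> {x \<in> V. \<phi> x = \<phi> v}"
        unfolding remove_atom_iff using v' by (auto simp: F_def)
    qed
    ultimately have "remove_atom B i = Z_P S k n (Some (\<phi> v mod m))" by (simp add: Z_P_Some)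
    then show "\<exists>p<m. remove_atom B i = Z_P S k n (Some p)"
      using m_pos by (intro exI[of _ "\<phi> v mod m"]) simp
  next
    \<comment> \<open>Connectedness is needed in the graph on \<open>B\<close>, not on
      \<open>F\<close>: all vertices of a path from \<open>z'\<close> lie in \<open>B\<close>
      themselves.\<close>
    have "(z', w) \<in> (nabla B)\<^sup>*" if "(z', w) \<in> (nabla F)\<^sup>*" for w
      using that
    proof (induction rule: rtrancl_induct)
      case (step x y)
      then have "x \<in> B" "y \<in> B"
        using rtrancl.rtrancl_into_rtrancl[of z' x "nabla F" y] by (auto simp: B_def nabla_def)
      then have "(x, y) \<in> nabla B" using step by (auto simp: nabla_def)
      then show ?case using step by auto
    qed simp
    moreover have "sym ((nabla B)\<^sup>*)" by (intro sym_rtrancl symI) (auto simp: nabla_def)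
    ultimately have "(w, w') \<in> (nabla B)\<^sup>*" if "w \<in> B" "w' \<in> B" for w w'
      using that by (auto simp: B_def intro: rtrancl_trans dest: symD)
    moreover have "z' \<in> B" using zF by (simp add: B_def)
    ultimately show "nabla_connected B" by (auto simp: nabla_connected_def)
  qed
  then show ?thesis using zF by (auto simp: B_def)
qed

text \<open>Otherwise membership in \<open>B\<close> would be invariant under all of \<open>\<rho>\<close>, but the degree of \<open>B\<close>
  also has factorizations involving \<open>m\<close>.\<close>

lemma relation_of_outer_betti:
  assumes B: "outer_betti S k n B"
  shows "\<exists>(z, z')\<in>\<rho>. 0 < z 0 \<and> z' \<in> B"
proof (rule ccontr)
  assume none: "\<not> ?thesis"
  have B0: "w 0 = 0" if "w \<in> B" for w using outer_betti_in(1)[OF B that] by (auto simp: vecs_def)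
  \<comment> \<open>No relation touches \<open>B\<close>: if \<open>z 0 = 0\<close> its degree is
    Apery, unlike that of \<open>B\<close>; otherwise \<open>z\<close> involves \<open>m\<close>,
    and \<open>z'\<close> is excluded by assumption.\<close>
  have none': "z \<notin> B \<and> z' \<notin> B" if r: "(z, z') \<in> \<rho>" for z z'
  proof (cases "z 0 = 0")
    case True
    then have "\<phi> z \<in> Ap" "\<phi> z' \<in> Ap" using rho_Ap_iff[OF r] rhoD[OF r] by auto
    then show ?thesis using outer_betti_in(3)[OF B] by blast
  next
    case False
    then show ?thesis using none r B0[of z] by auto
  qed
  define T where "T = {(x, y) \<in> ker_on V \<phi>. x \<in> B \<longleftrightarrow> y \<in> B}"
  \<comment> \<open>Any atom of a nonzero \<open>u\<close> is shared by \<open>x + u\<close> and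
    \<open>y + u\<close>.\<close>
  have step: "y + u \<in> B" if "x + u \<in> B" "x \<in> B \<longleftrightarrow> y \<in> B" "y \<in> V" "u \<in> V" "\<phi> x = \<phi> y" for x y u
  proof (cases "u = 0")
    case False
    then obtain i where "i \<in> supp u" using supp_empty_iff by blast
    then show ?thesis using outer_betti_adjacent[OF B that(1), of i "y + u"] that by simp
  qed (use that in simp)
  have "congruence V T"
  proof (rule congruenceI)
    fix x y u assume "(x, y) \<in> T" "u \<in> V"
    then show "(x + u, y + u) \<in> T"
      using step[of x u y] step[of y u x] by (auto simp: T_def ker_on_def)
  qed (auto simp: T_def ker_on_def)
  moreover have "\<rho> \<subseteq> T" using none' rho_subset by (auto simp: T_def)
  ultimately have T: "ker_on V \<phi> \<subseteq> T" unfolding hull_rho[symmetric] by (rule hull_minimal[rotated])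
  obtain w where w: "w \<in> B" using B by (auto simp: outer_betti_def nabla_connected_def)
  then obtain t where t: "t \<in> S" "\<phi> w = m + t"
    using Ap_iff[OF phi_S_in] outer_betti_in[OF B] by blast
  then obtain y where y: "y \<in> V" "\<phi> y = t" using S_factorization by metis
  have "(w, y + unit_vec 0) \<in> ker_on V \<phi>"
    using outer_betti_in(2)[OF B w] t y by (simp add: ker_on_def)
  then have "y + unit_vec 0 \<in> B" using T w by (auto simp: T_def)
  then have "(y + unit_vec 0) 0 = 0" by (rule B0)
  then show False by (simp add: plus_fun_apply unit_vec_def)
qed

text \<open>Two relations into \<open>B\<close> would close a cycle through the factorizations involving \<open>m\<close>.\<close>

lemma relation_of_outer_betti_unique:
  assumes B: "outer_betti S k n B" and r1: "(x, x') \<in> \<rho>" "0 < x 0" "x' \<in> B"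
    and r2: "(y, y') \<in> \<rho>" "0 < y 0" "y' \<in> B"
  shows "x' = y'"
proof (rule ccontr)
  assume "x' \<noteq> y'"
  let ?H = "congruence V hull (\<rho> - {(x, x')})"
  have deg: "\<phi> w = \<phi> x" if "w \<in> B" for w
    using outer_betti_degree[OF B r1(3) that] rhoD[OF r1(1)] by simp
  have "(x, y) \<in> ?H"
    using r1 r2 rhoD[OF r1(1)] rhoD[OF r2(1)] deg[OF r2(3)]
    by (intro shared_atom_related[OF r1(1), where i = 0]) (auto simp: supp_def)
  \<comment> \<open>The targets differ, so this relation survives the removal of
    \<open>(x, x')\<close>.\<close>
  moreover have "(y, y') \<in> ?H" using r2 \<open>x' \<noteq> y'\<close> by (intro hull_inc) auto
  moreover have "(y', x') \<in> (nabla B)\<^sup>*"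
    using B r1 r2 by (auto simp: outer_betti_def nabla_connected_def)
  then have "(y', x') \<in> ?H"
    using r2(3) deg outer_betti_in(2)[OF B] by (intro connected_related[OF r1(1), of B]) auto
  ultimately have "(x, x') \<in> ?H" using congruenceD(4)[OF congruence_hull_rho] by blast
  then show False using irredundant[OF r1(1)] by simp
qed

lemma targets: "{hat z' | z z'. (z, z') \<in> \<rho> \<and> 0 < z 0} = {z'. \<exists>z. (z, z') \<in> \<rho> \<and> 0 < z 0}"
proof -
  have "hat z' = z'" if "(z, z') \<in> \<rho>" for z z' using target_0[OF that] by (rule hat_eq)
  then show ?thesis by (auto; metis)
qed

end

theorem theorem5p12:
  fixes S :: "nat set" and k :: nat and n :: "nat \<Rightarrow> nat"
    and \<rho> :: "((nat \<Rightarrow> nat) \<times> (nat \<Rightarrow> nat)) set"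
  assumes "numerical_semigroup S"
    and "minimal_generators S k n"
    and "minimal_presentation_S S k n \<rho>"
    and "m_centric S k n \<rho>"
  shows "minimal_presentation_P S k n {(hat z, hat z') | z z'. (z, z') \<in> \<rho> \<and> z 0 = 0}
    \<and> {hat z' | z z'. (z, z') \<in> \<rho> \<and> 0 < z 0} \<subseteq> \<Union> {B. outer_betti S k n B}
    \<and> (\<forall>B. outer_betti S k n B \<longrightarrow>
          (\<exists>!w. w \<in> B \<and> w \<in> {hat z' | z z'. (z, z') \<in> \<rho> \<and> 0 < z 0}))"
proof -
  interpret kunz_presentation S k n \<rho> using assms by unfold_locales
  show ?thesis
    unfolding hat_Ap_relations targets
  proof (intro conjI allI impI)
    show "minimal_presentation_P S k n Ap_relations" by (rule minimal_presentation_P)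
    show "{z'. \<exists>z. (z, z') \<in> \<rho> \<and> 0 < z 0} \<subseteq> \<Union> {B. outer_betti S k n B}"
      using outer_betti_of_relation by blast
    fix B assume B: "outer_betti S k n B"
    show "\<exists>!w. w \<in> B \<and> w \<in> {z'. \<exists>z. (z, z') \<in> \<rho> \<and> 0 < z 0}"
      using relation_of_outer_betti[OF B] relation_of_outer_betti_unique[OF B] by blast
  qed
qed

end
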